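(* Let $K_W$ be the linear Gaussian transition with potential $W(x,y)=-\log g_\tau(y-(\alpha+\beta x))$, and let $\mu(dx)=e^{-U(x)}\lambda(dx)$, $\eta(dx)=e^{-V(x)}\lambda(dx)$ be probability measures on $\mathbb{R}^d$ whose potentials satisfy, for some $a_u,a_v>0$, $b_u,b_v\ge0$, $\delta_u,\delta_v\ge0$ and all $x\in\mathbb{R}^d$, $$\nabla^2U(x)\ge a_u 1_{\|x\|\ge\delta_u}I-b_u1_{\|x\|<\delta_u}I,\qquad \nabla^2V(x)\ge a_v1_{\|x\|\ge\delta_v}I-b_v1_{\|x\|<\delta_v}I.$$ Let $P_{\mu,\eta}=\mu\times\mathcal{L}_{\mu,\eta}$ be the Schrödinger bridge from $\mu$ to $\eta$ with respect to $P=\mu\times K_W$, let $\mathcal{P}_{2n}=\mu\times\mathcal{K}_{2n}$ be the even-indexed Sinkhorn bridges started at $\mathcal{P}_0=P$, and let $\rho_v$ be the constant described in the context. Then for any $n\ge1$, $$\|m_{2n}-m_{\mu,\eta}\|_{2,\mu}^2\le2\rho_v\,\mathcal{H}(P_{\mu,\eta}\,|\,\mathcal{P}_{2n}),$$ $$\|\sigma_{2n}-\sigma_{\mu,\eta}\|_{1,\mu}\le4\rho_v\,\mathcal{H}(P_{\mu,\eta}\,|\,\mathcal{P}_{2n})+c_{\mu,\eta}\bigl(8\rho_v\,\mathcal{H}(P_{\mu,\eta}\,|\,\mathcal{P}_{2n})\bigr)^{1/2},$$ where $c_{\mu,\eta}\ge0$ is defined by $c_{\mu,\eta}^2:=\i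nt\mu(dx)\,\mathrm{Tr}(\sigma_{\mu,\eta}(x))$.
   Context: Notation. $\lambda$ is Lebesgue measure on $\mathbb{R}^d$; $g_\tau$ is the density of the centered Gaussian on $\mathbb{R}^d$ with covariance matrix $\tau>0$ (positive definite); $\alpha\in\mathbb{R}^d$; $\beta\in\mathbb{R}^{d\times d}$ is invertible; $K_W(x,dy)=e^{-W(x,y)}\lambda(dy)$. The potentials $U,V$ are twice differentiable. Inequalities between symmetric matrices are in the Loewner order. For a Markov transition $\mathcal{K}$: $(\mu\times\mathcal{K})(d(x,y))=\mu(dx)\mathcal{K}(x,dy)$, $m_{\mathcal{K}}(x)=\int\mathcal{K}(x,dy)y$ and $\sigma_{\mathcal{K}}(x)=\int\mathcal{K}(x,dy)(y-m_{\mathcal{K}}(x))(y-m_{\mathcal{K}}(x))^{\prime}$ ($^{\prime}$ is transposition). Put $m_{\mu,\eta}=m_{\mathcal{L}_{\mu,\eta}}$, $\sigma_{\mu,\eta}=\sigma_{\mathcal{L}_{\mu,\eta}}$, $m_{2n}=m_{\mathcal{K}_{2n}}$, $\sigma_{2n}=\sigma_{\mathcal{K}_{2n}}$. The relative entropy is $\mathcal{H}(\mu\,|\,\eta)=\int\log(d\mu/d\eta)d\mu$ if $\mu\ll\eta$, and $\infty$ otherwise. For measurable matrix- or vector-valued $v$, $\|v\|_{p,\mu}^p=\int\mu(dx)\|v(x)\|_F^p$ with $\|v\|_F=\sqrt{\mathrm{Tr}(v^{\prime}v)}$. Bridges. $\Pi(\mu,\eta)$ is the set of probability measures on $\mathbb{R}^d\times\mathbb{R}^d$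 with marginals $\mu$ (first) and $\eta$ (second). With $P=\mu\times K_W$, the Schrödinger bridge is $P_{\mu,\eta}=\mathrm{argmin}_{Q\in\Pi(\mu,\eta)}\mathcal{H}(Q\,|\,P)$; it is assumed that some $Q\in\Pi(\mu,\eta)$ has $\mathcal{H}(Q\,|\,P)<\infty$. Its disintegration is $P_{\mu,\eta}=\mu\times\mathcal{L}_{\mu,\eta}$. Sinkhorn bridges: $\mathcal{P}_0=P$, i.e. $\mathcal{K}_0=K_W$; $\mathcal{P}_{2n}(d(x,y))=\mu(dx)\mathcal{K}_{2n}(x,dy)$ and $\mathcal{P}_{2n+1}(d(x,y))=\eta(dy)\mathcal{K}_{2n+1}(y,dx)$, where $\mathcal{K}_{2n+1}$ is the $\mathcal{P}_{2n}$-conditional distribution of the first coordinate given the second and $\mathcal{K}_{2(n+1)}$ is the $\mathcal{P}_{2n+1}$-conditional distribution of the second coordinate given the first. (Equivalently $\mathcal{P}_{2n+1}$ minimizes $\mathcal{H}(\cdot\,|\,\mathcal{P}_{2n})$ among measures with second marginal $\eta$, and $\mathcal{P}_{2(n+1)}$ minimizes $\mathcal{H}(\cdot\,|\,\mathcal{P}_{2n+1})$ among measures with first marginal $\mu$.) Constant $\rho_v$. A probability measure $\mu$ satisfies $LS(\rho)$ if $\mathcal{H}(\nu\,|\,\mu)\le\frac{\rho}{2}\int\|\nabla\log(d\nu/d\mu)\|^2d\nu$ for all probability measures $\nu$ (right-hand side $\infty$ if $\nu\not\ll\mu$); it satisfies $\mathbb{T}_2(\rho)$ if $\frac12\mathcal{D}_2(\nu,\mu)^2\le\rho\,\mathcal{H}(\nu\,|\,\mu)$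 for all $\nu$, where $\mathcal{D}_2$ is the 2-Wasserstein distance; $LS(\rho)$ implies $\mathbb{T}_2(\rho)$. A Markov transition satisfies one of these if all measures $\mathcal{K}(x,\cdot)$ do. It is known that the curvature condition on $V$ ensures that $\mathcal{L}_{\mu,\eta}$, all $\mathcal{K}_{2n}$ with $n\ge1$, and $\eta$ satisfy $LS(\rho_v)$, and thus $\mathbb{T}_2(\rho_v)$, for some $\rho_v>0$ depending on $(a_v,b_v,\delta_v)$ (with $\rho_v=1/a_v$ allowed when $\delta_v=0$); $\rho_v$ denotes such a constant. *)

theory Defs
  imports "HOL-Probability.Probability"
begin

section \<open>Matrices and curvature\<close>

definition positive_definite :: "real^'d^'d \<Rightarrow> bool" where
  "positive_definite A \<longleftrightarrow> transpose A = A \<and> (\<forall>x. x \<noteq> 0 \<longrightarrow> 0 < x \<bullet> (A *v x))"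

definition positive_semidefinite :: "real^'d^'d \<Rightarrow> bool" where
  "positive_semidefinite A \<longleftrightarrow> transpose A = A \<and> (\<forall>x. 0 \<le> x \<bullet> (A *v x))"

definition loewner_le :: "real^'d^'d \<Rightarrow> real^'d^'d \<Rightarrow> bool" where
  "loewner_le A B \<longleftrightarrow> positive_semidefinite (B - A)"

text \<open>Twice (Frechet) differentiable at every point, with Hessian matrix \<open>H x\<close> at \<open>x\<close>;
  the Hessian is not required to be continuous.\<close>

definition has_hessian :: "(real^'d \<Rightarrow> real) \<Rightarrow> (real^'d \<Rightarrow> real^'d^'d) \<Rightarrow> bool" where
  "has_hessian U H \<longleftrightarrow>
     (\<exists>G. (\<forall>x. GDERIV U x :> G x) \<and> (\<forall>x. (G has_derivative (\<lambda>h. H x *v h)) (at x)))"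

definition curvature_bound :: "(real^'d \<Rightarrow> real) \<Rightarrow> real \<Rightarrow> real \<Rightarrow> real \<Rightarrow> bool" where
  "curvature_bound U a b \<delta> \<longleftrightarrow>
     (\<exists>H. has_hessian U H \<and>
       (\<forall>x. loewner_le
          ((a * indicator {z. \<delta> \<le> norm z} x - b * indicator {z. norm z < \<delta>} x) *\<^sub>R mat 1)
          (H x)))"

text \<open>The library norm on \<open>real^'n^'m\<close> is the Frobenius norm.\<close>

lemma norm_matrix_eq_frobenius:
  fixes A :: "real^'n^'m"
  shows "norm A = sqrt (trace (transpose A ** A))"
proof -
  have "(norm A)\<^sup>2 = (\<Sum>i\<in>UNIV. \<Sum>j\<in>UNIV. (A $ i $ j)\<^sup>2)"
    unfolding power2_norm_eq_inner inner_vec_def by (simp add: power2_eq_square)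
  also have "\<dots> = (\<Sum>j\<in>UNIV. \<Sum>i\<in>UNIV. (A $ i $ j)\<^sup>2)"
    by (rule sum.swap)
  also have "\<dots> = trace (transpose A ** A)"
    by (simp add: trace_def matrix_matrix_mult_def transpose_def power2_eq_square)
  finally show ?thesis
    by (metis norm_ge_zero real_sqrt_unique)
qed


section \<open>Extended nonnegative functionals of measures\<close>

definition ennreal_sqrt :: "ennreal \<Rightarrow> ennreal" where
  "ennreal_sqrt x = (if x = \<top> then \<top> else ennreal (sqrt (enn2real x)))"

text \<open>\<open>relative_entropy \<nu> \<mu>\<close> is the entropy of \<open>\<nu>\<close> with respect to \<open>\<mu>\<close>; note the reversed argument
  order of the library's \<^const>\<open>KL_divergence\<close>, whose Bochner integral is 0 when the integrand is not
  integrable. For probability measures with \<open>\<nu>\<close> absolutely continuous with respect to \<open>\<mu>\<close>, the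
  negative part of \<open>log (d\<nu>/d\<mu>)\<close> is always \<open>\<nu>\<close>-integrable, so that the only non-integrable case is
  the one where the integral is infinite, and the integral is never negative.\<close>

definition relative_entropy :: "'a measure \<Rightarrow> 'a measure \<Rightarrow> ennreal" where
  "relative_entropy \<nu> \<mu> =
     (if sets \<nu> = sets \<mu> \<and> absolutely_continuous \<mu> \<nu> \<and>
         integrable \<nu> (entropy_density (exp 1) \<mu> \<nu>)
      then ennreal (KL_divergence (exp 1) \<mu> \<nu>) else \<top>)"

definition lp_norm_pow :: "nat \<Rightarrow> 'a measure \<Rightarrow> ('a \<Rightarrow> 'b::real_normed_vector) \<Rightarrow> ennreal" where
  "lp_norm_pow p \<mu> v = (\<integral>\<^sup>+x. ennreal (norm (v x) ^ p) \<partial>\<mu>)"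

definition couplings ::
  "'a::topological_space measure \<Rightarrow> 'b::topological_space measure \<Rightarrow> ('a \<times> 'b) measure set" where
  "couplings \<mu> \<eta> =
     {Q. prob_space Q \<and> sets Q = sets (borel \<Otimes>\<^sub>M borel) \<and>
         distr Q borel fst = \<mu> \<and> distr Q borel snd = \<eta>}"

definition wasserstein2 :: "(real^'d) measure \<Rightarrow> (real^'d) measure \<Rightarrow> ennreal" where
  "wasserstein2 \<nu> \<mu> =
     ennreal_sqrt (INF Q\<in>couplings \<nu> \<mu>. \<integral>\<^sup>+z. ennreal ((norm (fst z - snd z))\<^sup>2) \<partial>Q)"

text \<open>The integral of \<open>\<parallel>\<nabla> log (d\<nu>/d\<mu>)\<parallel>\<^sup>2\<close> with respect to \<open>\<nu>\<close>. It is infinite unless \<open>d\<nu>/d\<mu>\<close> has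
  a positive version \<open>f\<close> whose logarithm is differentiable at every point. Differentiability almost
  everywhere would not do: locally constant densities with jumps would get the value 0.
  The infimum is over the versions; if \<open>\<mu>\<close> has full support there is at most one.\<close>

definition fisher_information :: "(real^'d) measure \<Rightarrow> (real^'d) measure \<Rightarrow> ennreal" where
  "fisher_information \<nu> \<mu> =
     (INF (f, G) \<in> {(f, G). (\<forall>x. 0 < f x \<and> GDERIV (\<lambda>y. ln (f y)) x :> G x) \<and>
                            \<nu> = density \<mu> (\<lambda>x. ennreal (f x))}.
        \<integral>\<^sup>+x. ennreal ((norm (G x))\<^sup>2) \<partial>\<nu>)"

definition log_sobolev :: "real \<Rightarrow> (real^'d) measure \<Rightarrow> bool" where
  "log_sobolev \<rho> \<mu> \<longleftrightarrow>
     (\<forall>\<nu>. prob_space \<nu> \<and> sets \<nu> = sets borel \<longrightarrow>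
        relative_entropy \<nu> \<mu> \<le> ennreal (\<rho> / 2) * fisher_information \<nu> \<mu>)"

definition quadratic_transport :: "real \<Rightarrow> (real^'d) measure \<Rightarrow> bool" where
  "quadratic_transport \<rho> \<mu> \<longleftrightarrow>
     (\<forall>\<nu>. prob_space \<nu> \<and> sets \<nu> = sets borel \<longrightarrow>
        ennreal (1 / 2) * (wasserstein2 \<nu> \<mu>)\<^sup>2 \<le> ennreal \<rho> * relative_entropy \<nu> \<mu>)"


section \<open>Markov transitions\<close>

definition markov_transition :: "(real^'d \<Rightarrow> (real^'d) measure) \<Rightarrow> bool" where
  "markov_transition K \<longleftrightarrow> K \<in> borel \<rightarrow>\<^sub>M prob_algebra borel"

definition kernel_product ::
  "(real^'d) measure \<Rightarrow> (real^'d \<Rightarrow> (real^'d) measure) \<Rightarrow> ((real^'d) \<times> (real^'d)) measure" where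
  "kernel_product \<mu> K = \<mu> \<bind> (\<lambda>x. distr (K x) (borel \<Otimes>\<^sub>M borel) (\<lambda>y. (x, y)))"

definition swap_measure ::
  "((real^'d) \<times> (real^'d)) measure \<Rightarrow> ((real^'d) \<times> (real^'d)) measure" where
  "swap_measure Q = distr Q (borel \<Otimes>\<^sub>M borel) prod.swap"

definition cond_second_given_first ::
  "((real^'d) \<times> (real^'d)) measure \<Rightarrow> (real^'d \<Rightarrow> (real^'d) measure) \<Rightarrow> bool" where
  "cond_second_given_first Q K \<longleftrightarrow>
     markov_transition K \<and> Q = kernel_product (distr Q borel fst) K"

definition cond_first_given_second ::
  "((real^'d) \<times> (real^'d)) measure \<Rightarrow> (real^'d \<Rightarrow> (real^'d) measure) \<Rightarrow> bool" where
  "cond_first_given_second Q K \<longleftrightarrow>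
     markov_transition K \<and> Q = swap_measure (kernel_product (distr Q borel snd) K)"

definition kernel_mean :: "(real^'d \<Rightarrow> (real^'d) measure) \<Rightarrow> real^'d \<Rightarrow> real^'d" where
  "kernel_mean K x = (\<integral>y. y \<partial>K x)"

definition outer_product :: "real^'d \<Rightarrow> real^'d \<Rightarrow> real^'d^'d" where
  "outer_product v w = (\<chi> i j. v $ i * w $ j)"

definition kernel_covariance :: "(real^'d \<Rightarrow> (real^'d) measure) \<Rightarrow> real^'d \<Rightarrow> real^'d^'d" where
  "kernel_covariance K x =
     (\<integral>y. outer_product (y - kernel_mean K x) (y - kernel_mean K x) \<partial>K x)"


section \<open>Gibbs measures and linear Gaussian transitions\<close>

definition gibbs_measure :: "(real^'d \<Rightarrow> real) \<Rightarrow> (real^'d) measure" where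
  "gibbs_measure U = density lborel (\<lambda>x. ennreal (exp (- U x)))"

definition gaussian_density :: "real^'d^'d \<Rightarrow> real^'d \<Rightarrow> real" where
  "gaussian_density \<tau> z =
     exp (- (z \<bullet> (matrix_inv \<tau> *v z)) / 2) / sqrt ((2 * pi) ^ CARD('d) * det \<tau>)"

definition gaussian_potential ::
  "real^'d \<Rightarrow> real^'d^'d \<Rightarrow> real^'d^'d \<Rightarrow> real^'d \<Rightarrow> real^'d \<Rightarrow> real" where
  "gaussian_potential \<alpha> \<beta> \<tau> x y = - ln (gaussian_density \<tau> (y - (\<alpha> + \<beta> *v x)))"

definition potential_transition ::
  "(real^'d \<Rightarrow> real^'d \<Rightarrow> real) \<Rightarrow> real^'d \<Rightarrow> (real^'d) measure" where
  "potential_transition W x = gibbs_measure (W x)"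


section \<open>Schroedinger and Sinkhorn bridges\<close>

definition schroedinger_bridge ::
  "((real^'d) \<times> (real^'d)) measure \<Rightarrow> (real^'d) measure \<Rightarrow> (real^'d) measure
    \<Rightarrow> ((real^'d) \<times> (real^'d)) measure \<Rightarrow> bool" where
  "schroedinger_bridge P \<mu> \<eta> B \<longleftrightarrow>
     is_arg_min (\<lambda>Q. relative_entropy Q P) (\<lambda>Q. Q \<in> couplings \<mu> \<eta>) B"

definition sinkhorn_bridge ::
  "(real^'d) measure \<Rightarrow> (real^'d) measure \<Rightarrow> (nat \<Rightarrow> real^'d \<Rightarrow> (real^'d) measure)
    \<Rightarrow> nat \<Rightarrow> ((real^'d) \<times> (real^'d)) measure" where
  "sinkhorn_bridge \<mu> \<eta> K n =
     (if even n then kernel_product \<mu> (K n) else swap_measure (kernel_product \<eta> (K n)))"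

text \<open>\<open>K\<close> is a sequence of Sinkhorn transitions started at \<open>K0\<close>. Conditional distributions are only
  determined up to null sets, so \<open>K\<close> stands for an arbitrary choice of versions.\<close>

definition sinkhorn_transitions ::
  "(real^'d) measure \<Rightarrow> (real^'d) measure \<Rightarrow> (real^'d \<Rightarrow> (real^'d) measure)
    \<Rightarrow> (nat \<Rightarrow> real^'d \<Rightarrow> (real^'d) measure) \<Rightarrow> bool" where
  "sinkhorn_transitions \<mu> \<eta> K0 K \<longleftrightarrow>
     K 0 = K0 \<and>
     (\<forall>n. cond_first_given_second (sinkhorn_bridge \<mu> \<eta> K (2 * n)) (K (2 * n + 1)) \<and>
          cond_second_given_first (sinkhorn_bridge \<mu> \<eta> K (2 * n + 1)) (K (2 * (n + 1))))"

text \<open>A constant \<open>\<rho>\<close> for which the log-Sobolev inequality, and thus (by the Otto-Villani theorem) the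
  quadratic transportation cost inequality, holds for \<open>\<eta>\<close>, for the bridge transition \<open>L\<close>, and for
  the even Sinkhorn transitions other than the initial one.\<close>

definition bridge_constant ::
  "(real^'d) measure \<Rightarrow> (real^'d \<Rightarrow> (real^'d) measure)
    \<Rightarrow> (nat \<Rightarrow> real^'d \<Rightarrow> (real^'d) measure) \<Rightarrow> real \<Rightarrow> bool" where
  "bridge_constant \<eta> L K \<rho> \<longleftrightarrow>
     0 < \<rho> \<and>
     log_sobolev \<rho> \<eta> \<and> quadratic_transport \<rho> \<eta> \<and>
     (\<forall>x. log_sobolev \<rho> (L x) \<and> quadratic_transport \<rho> (L x)) \<and>
     (\<forall>n\<ge>1. \<forall>x. log_sobolev \<rho> (K (2 * n) x) \<and> quadratic_transport \<rho> (K (2 * n) x))"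

text \<open>The mean conditional variance is taken as an extended nonnegative integral, so that the
  constant is \<open>\<top>\<close> rather than 0 should the integral diverge.\<close>

definition bridge_spread :: "(real^'d) measure \<Rightarrow> (real^'d \<Rightarrow> (real^'d) measure) \<Rightarrow> ennreal" where
  "bridge_spread \<mu> L = ennreal_sqrt (\<integral>\<^sup>+x. ennreal (trace (kernel_covariance L x)) \<partial>\<mu>)"

end

theory Submission
  imports Defs
begin

text \<open>
  Both bounds are first proved for each starting point \<open>x\<close> and then integrated over \<open>\<mu>\<close>.

  For a fixed \<open>x\<close>, take any coupling \<open>(Y, Z)\<close> of \<open>L x\<close> and \<open>K x\<close>, and let \<open>c\<close> be the mean of
  \<open>\<parallel>Z - Y\<parallel>\<^sup>2\<close>. By Jensen's inequality the means of the two laws differ by at most \<open>\<surd>c\<close>. If \<open>Y'\<close> and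
  \<open>Z'\<close> are the centred vectors and \<open>D = Z' - Y'\<close>, then \<open>Z' \<otimes> Z' - Y' \<otimes> Y' = D \<otimes> D + D \<otimes> Y' + Y' \<otimes> D\<close>;
  centring does not increase the mean of the squared norm, and so, by the Cauchy--Schwarz inequality,
  the covariances differ by at most \<open>c + 2 \<surd>c \<surd>Tr \<sigma>\<close> in Frobenius norm, where \<open>\<sigma>\<close> is the covariance
  of \<open>L x\<close> (lemma \<open>coupling_moment_bounds\<close>). Passing to the infimum over the couplings replaces \<open>c\<close>
  by the squared Wasserstein distance, which the quadratic transportation cost inequality for \<open>K x\<close>
  bounds by \<open>2 \<rho>\<close> times the relative entropy of \<open>L x\<close> with respect to \<open>K x\<close>
  (lemma \<open>quadratic_transport_moment_bounds\<close>).

  All these moments are finite because the same inequality forces finite second moments: conditioning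
  the measure on a ball of positive mass costs finite entropy and gives bounded support, and a law at
  finite Wasserstein distance from a compactly supported one has finite second moment
  (lemma \<open>quadratic_transport_imp_square_integrable\<close>).

  To integrate over \<open>x\<close>, the chain rule is needed: the two bridges have the same first marginal, and
  so the \<open>\<mu>\<close>-mean of the relative entropies of the transitions is the relative entropy of the bridges
  (lemma \<open>nn_integral_relative_entropy_transition\<close>). It follows from the almost sure uniqueness of
  disintegrations, once the entropy is written as the integral of the nonnegative function
  \<open>t log t - t + 1\<close> of the density, to which Tonelli's theorem applies without integrability
  conditions. The cross term of the covariance bound is integrated by the Cauchy--Schwarz
  inequality once more.
\<close>

section \<open>Square roots of extended nonnegative reals\<close>

lemma ennreal_sqrt_power2: "(ennreal_sqrt x)\<^sup>2 = x"
  by (cases x) (auto simp: ennreal_sqrt_def ennreal_power)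

lemma ennreal_sqrt_ennreal: "0 \<le> r \<Longrightarrow> ennreal_sqrt (ennreal r) = ennreal (sqrt r)"
  by (simp add: ennreal_sqrt_def)

lemma borel_measurable_ennreal_sqrt [measurable]: "ennreal_sqrt \<in> borel_measurable borel"
  unfolding ennreal_sqrt_def by measurable

text \<open>This turns the squared form of the Cauchy--Schwarz inequality for nonnegative integrals into the
  form with roots, also when a factor is infinite.\<close>

lemma le_ennreal_sqrt_mult:
  assumes "x\<^sup>2 \<le> y * z"
  shows "x \<le> ennreal_sqrt y * ennreal_sqrt z"
proof -
  have "(ennreal_sqrt y * ennreal_sqrt z)\<^sup>2 = y * z"
    by (simp add: power_mult_distrib ennreal_sqrt_power2)
  with assms have *: "x\<^sup>2 \<le> (ennreal_sqrt y * ennreal_sqrt z)\<^sup>2"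
    by simp
  show ?thesis
  proof (cases x)
    case (real r)
    then show ?thesis
    proof (cases "ennreal_sqrt y * ennreal_sqrt z")
      case (real s)
      with * \<open>x = ennreal r\<close> \<open>0 \<le> r\<close> show ?thesis
        by (auto simp: ennreal_power intro!: ennreal_leI dest: power2_le_imp_le)
    qed simp
  next
    case top
    with * show ?thesis
      by (cases "ennreal_sqrt y * ennreal_sqrt z") (auto simp: ennreal_power top_unique)
  qed
qed


section \<open>Relative entropy in terms of a density\<close>

text \<open>Subtracting the mass of the density and adding that of the reference measure leaves the entropy of
  a probability density unchanged, but makes the integrand nonnegative.\<close>

definition entropy_integrand :: "real \<Rightarrow> real" where
  "entropy_integrand t = t * ln t - t + 1"

lemma entropy_integrand_nonneg:
  assumes "0 \<le> t"
  shows "0 \<le> entropy_integrand t"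
proof (cases "t = 0")
  case False
  with assms have "ln (1 / t) \<le> 1 / t - 1"
    by (intro ln_le_minus_one) auto
  then have "t * (- ln t) \<le> t * (1 / t - 1)"
    using False assms by (intro mult_left_mono) (auto simp: ln_div)
  then show ?thesis
    using False by (simp add: entropy_integrand_def algebra_simps)
qed (simp add: entropy_integrand_def)

lemma borel_measurable_entropy_integrand [measurable]:
  "entropy_integrand \<in> borel_measurable borel"
  unfolding entropy_integrand_def by measurable

text \<open>Since the density \<open>f\<close> is integrable, \<open>f log f\<close> is integrable if and only if
  \<open>f log f - f + 1\<close> is, so that the nonnegative integral is infinite exactly when the entropy is
  set to \<open>\<top>\<close> by definition.\<close>

lemma relative_entropy_density:
  fixes f :: "'a \<Rightarrow> real"
  assumes "prob_space M" and f [measurable]: "f \<in> borel_measurable M" and nn: "\<And>x. 0 \<le> f x"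
    and "prob_space (density M (\<lambda>x. ennreal (f x)))"
  shows "relative_entropy (density M (\<lambda>x. ennreal (f x))) M
    = (\<integral>\<^sup>+x. ennreal (entropy_integrand (f x)) \<partial>M)"
proof -
  interpret M: prob_space M by fact
  let ?N = "density M (\<lambda>x. ennreal (f x))"
  interpret N: prob_space ?N by fact
  have mass: "(\<integral>\<^sup>+x. ennreal (f x) \<partial>M) = 1"
    using N.emeasure_space_1 by (simp add: emeasure_density cong: nn_integral_cong)
  then have int_f: "integrable M f" and "(\<integral>x. f x \<partial>M) = 1"
    using nn by (auto intro!: integrableI_nonneg simp: integral_eq_nn_integral)
  have ac: "absolutely_continuous M ?N"
    by (auto intro!: absolutely_continuousI_density)
  have "AE x in M. ennreal (f x) = RN_deriv M ?N x"
    by (intro M.RN_deriv_unique) auto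
  then have "AE x in M. entropy_density (exp 1) M ?N x = ln (f x)"
    by eventually_elim (use nn in \<open>auto simp: entropy_density_def log_def\<close>, metis enn2real_ennreal nn)
  then have "integrable ?N (entropy_density (exp 1) M ?N) \<longleftrightarrow> integrable ?N (\<lambda>x. ln (f x))"
    by (intro integrable_cong_AE) (auto simp: AE_density)
  also have "\<dots> \<longleftrightarrow> integrable M (\<lambda>x. f x * ln (f x))"
    using nn by (subst integrable_real_density) auto
  also have "\<dots> \<longleftrightarrow> integrable M (\<lambda>x. entropy_integrand (f x))"
  proof
    assume "integrable M (\<lambda>x. entropy_integrand (f x))"
    then have "integrable M (\<lambda>x. entropy_integrand (f x) + f x - 1)"
      using int_f by auto
    then show "integrable M (\<lambda>x. f x * ln (f x))"
      by (simp add: entropy_integrand_def)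
  qed (use int_f in \<open>auto simp: entropy_integrand_def\<close>)
  finally have integrable_iff: "integrable ?N (entropy_density (exp 1) M ?N) \<longleftrightarrow>
      integrable M (\<lambda>x. entropy_integrand (f x))" .
  show ?thesis
  proof (cases "integrable M (\<lambda>x. entropy_integrand (f x))")
    case True
    then have "integrable M (\<lambda>x. entropy_integrand (f x) + f x - 1)"
      using int_f by auto
    then have "integrable M (\<lambda>x. f x * ln (f x))"
      by (simp add: entropy_integrand_def)
    then have "(\<integral>x. entropy_integrand (f x) \<partial>M) = (\<integral>x. f x * ln (f x) \<partial>M)"
      using int_f \<open>(\<integral>x. f x \<partial>M) = 1\<close> by (simp add: entropy_integrand_def M.prob_space)
    also have "\<dots> = KL_divergence (exp 1) M ?N"
      using nn by (subst M.KL_density) (auto simp: log_def)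
    finally show ?thesis
      using True integrable_iff ac
      by (simp add: relative_entropy_def nn_integral_eq_integral nn entropy_integrand_nonneg)
  next
    case False
    then have "(\<integral>\<^sup>+x. ennreal (entropy_integrand (f x)) \<partial>M) = \<top>"
      by (subst (asm) integrable_iff_bounded)
        (auto simp: nn entropy_integrand_nonneg not_less top_unique)
    with False integrable_iff show ?thesis
      by (simp add: relative_entropy_def)
  qed
qed

lemma finite_relative_entropy_imp_density:
  assumes "prob_space M" "prob_space N" and finite: "relative_entropy N M < \<top>"
  obtains f where "f \<in> borel_measurable M" "\<And>x. 0 \<le> f x" "N = density M (\<lambda>x. ennreal (f x))"
proof -
  interpret M: prob_space M by fact
  interpret N: prob_space N by fact
  have fm: "finite_measure N" by unfold_locales
  have ac: "absolutely_continuous M N" and sets: "sets N = sets M"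
    using finite by (auto simp: relative_entropy_def split: if_splits)
  obtain f where f: "f \<in> borel_measurable M" "AE x in M. RN_deriv M N x = ennreal (f x)"
      "\<And>x. 0 \<le> f x"
    using M.real_RN_deriv[OF fm ac sets] by blast
  have "N = density M (RN_deriv M N)"
    using M.density_RN_deriv[OF ac sets] by simp
  also have "\<dots> = density M (\<lambda>x. ennreal (f x))"
    using f by (intro density_cong) auto
  finally show ?thesis using that f by blast
qed


section \<open>Disintegration and the chain rule for the relative entropy\<close>

lemma markov_transitionD:
  assumes "markov_transition K"
  shows "K \<in> borel \<rightarrow>\<^sub>M subprob_algebra borel" "prob_space (K x)"
    "sets (K x) = sets borel" "space (K x) = UNIV"
proof -
  have K: "K \<in> borel \<rightarrow>\<^sub>M prob_algebra borel"
    using assms by (simp add: markov_transition_def)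
  then show "K \<in> borel \<rightarrow>\<^sub>M subprob_algebra borel"
    by (rule measurable_prob_algebraD)
  have "K x \<in> space (prob_algebra borel)"
    using measurable_space[OF K] by simp
  then show "prob_space (K x)" and *: "sets (K x) = sets borel"
    by (auto simp: space_prob_algebra)
  show "space (K x) = UNIV"
    using sets_eq_imp_space_eq[OF *] by simp
qed

context
  fixes \<mu> :: "(real^'d) measure" and K :: "real^'d \<Rightarrow> (real^'d) measure"
  assumes sets_\<mu> [measurable_cong, simp]: "sets \<mu> = sets borel"
    and K: "markov_transition K"
begin

lemma graph_transition_measurable:
  "(\<lambda>x. distr (K x) (borel \<Otimes>\<^sub>M borel) (\<lambda>y. (x, y))) \<in> \<mu> \<rightarrow>\<^sub>M prob_algebra (borel \<Otimes>\<^sub>M borel)"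
proof -
  have [measurable]: "K \<in> borel \<rightarrow>\<^sub>M prob_algebra borel"
    using K by (simp add: markov_transition_def)
  show ?thesis by measurable
qed

lemma sets_kernel_product: "sets (kernel_product \<mu> K) = sets (borel \<Otimes>\<^sub>M borel)"
  unfolding kernel_product_def
  using sets_eq_imp_space_eq[OF sets_\<mu>]
  by (subst sets_bind) (auto simp: space_pair_measure)

lemma prob_space_kernel_product:
  assumes "prob_space \<mu>"
  shows "prob_space (kernel_product \<mu> K)"
  unfolding kernel_product_def
  by (rule prob_space_bind'[OF _ graph_transition_measurable])
    (use assms in \<open>simp add: space_prob_algebra\<close>)

lemma nn_integral_kernel_product:
  assumes g [measurable]: "g \<in> borel_measurable (borel \<Otimes>\<^sub>M borel)"
  shows "(\<integral>\<^sup>+z. g z \<partial>kernel_product \<mu> K) = (\<integral>\<^sup>+x. \<integral>\<^sup>+y. g (x, y) \<partial>K x \<partial>\<mu>)"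
proof -
  have [measurable_cong]: "sets (K x) = sets borel" for x
    using K by (rule markov_transitionD)
  show ?thesis
    unfolding kernel_product_def
    by (subst nn_integral_bind[OF g measurable_prob_algebraD[OF graph_transition_measurable]])
      (simp add: nn_integral_distr)
qed

lemma borel_measurable_nn_integral_transition:
  assumes "g \<in> borel_measurable (borel \<Otimes>\<^sub>M borel)"
  shows "(\<lambda>x. \<integral>\<^sup>+y. g (x, y) \<partial>K x) \<in> borel_measurable \<mu>"
  using nn_integral_measurable_subprob_algebra2[of "\<lambda>x y. g (x, y)" borel borel K]
    markov_transitionD(1)[OF K] assms by simp

end

text \<open>Finite intersections of the members of a countable base. Countability allows almost sure equalities
  for single sets to be combined into an almost sure equality of measures.\<close>

lemma countable_intersection_stable_generator:
  obtains G :: "'a::second_countable_topology set set"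
  where "countable G" "Int_stable G" "UNIV \<in> G" "sets borel = sigma_sets UNIV G"
proof -
  obtain B :: "'a set set" where B: "countable B" "topological_basis B"
    using ex_countable_basis by blast
  define G where "G = Inter ` {F. finite F \<and> F \<subseteq> B}"
  have "countable G"
    unfolding G_def using B(1) by (intro countable_image countable_Collect_finite_subset)
  moreover have "Int_stable G"
  proof (rule Int_stableI)
    fix X Y assume "X \<in> G" "Y \<in> G"
    then obtain F F' where "finite F" "F \<subseteq> B" "finite F'" "F' \<subseteq> B" "X = \<Inter>F" "Y = \<Inter>F'"
      by (auto simp: G_def)
    then show "X \<inter> Y \<in> G"
      unfolding G_def by (intro image_eqI[of _ _ "F \<union> F'"]) auto
  qed
  moreover have "UNIV \<in> G"
    unfolding G_def by (intro image_eqI[of _ _ "{}"]) auto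
  moreover have "sets borel = sigma_sets UNIV G"
  proof -
    have "B \<subseteq> G"
      unfolding G_def by (auto intro!: image_eqI[of _ Inter "{b}" for b])
    have open_G: "open X" if "X \<in> G" for X
      using that topological_basis_open[OF B(2)] by (auto simp: G_def)
    have "sets borel = sigma_sets UNIV B"
      by (simp add: borel_eq_countable_basis[OF B])
    also have "\<dots> \<subseteq> sigma_sets UNIV G"
      using \<open>B \<subseteq> G\<close> by (rule sigma_sets_mono')
    finally have "sets borel \<subseteq> sigma_sets UNIV G" .
    moreover have "sigma_sets UNIV G \<subseteq> sets borel"
    proof -
      have "G \<subseteq> sets borel"
        using open_G by auto
      then show ?thesis
        using sets.sigma_sets_subset[of G borel] by simp
    qed
    ultimately show ?thesis by blast
  qed
  ultimately show ?thesis by (rule that)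
qed

text \<open>Disintegrations are almost surely unique: testing the hypothesis on rectangles \<open>E \<times> A\<close> identifies,
  for a fixed \<open>A\<close>, the two values at \<open>A\<close> for almost every \<open>x\<close>, and a countable intersection-stable
  generator lets the null set be chosen independently of \<open>A\<close>.\<close>

lemma kernel_product_density_imp_AE_density:
  fixes f :: "(real^'d) \<times> (real^'d) \<Rightarrow> ennreal"
  assumes "prob_space \<mu>" and sets_\<mu> [measurable_cong, simp]: "sets \<mu> = sets borel"
    and K: "markov_transition K" and L: "markov_transition L"
    and f [measurable]: "f \<in> borel_measurable (borel \<Otimes>\<^sub>M borel)"
    and eq: "kernel_product \<mu> L = density (kernel_product \<mu> K) f"
  shows "AE x in \<mu>. L x = density (K x) (\<lambda>y. f (x, y))"
proof -
  interpret prob_space \<mu> by fact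
  note [measurable_cong] = markov_transitionD(3)[OF K] markov_transitionD(3)[OF L]
    sets_kernel_product[OF sets_\<mu> K] sets_kernel_product[OF sets_\<mu> L]
  have AE_eq: "AE x in \<mu>. emeasure (L x) A = emeasure (density (K x) (\<lambda>y. f (x, y))) A"
    if [measurable]: "A \<in> sets borel" for A
  proof -
    have "AE x in \<mu>. (\<integral>\<^sup>+y. indicator A y \<partial>L x) = (\<integral>\<^sup>+y. f (x, y) * indicator A y \<partial>K x)"
    proof (rule density_unique_finite_measure)
      show "(\<lambda>x. \<integral>\<^sup>+y. indicator A y \<partial>L x) \<in> borel_measurable \<mu>"
        using borel_measurable_nn_integral_transition[OF sets_\<mu> L, of "\<lambda>z. indicator A (snd z)"]
        by simp
      show "(\<lambda>x. \<integral>\<^sup>+y. f (x, y) * indicator A y \<partial>K x) \<in> borel_measurable \<mu>"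
        using borel_measurable_nn_integral_transition[OF sets_\<mu> K, of "\<lambda>z. f z * indicator A (snd z)"]
        by simp
    next
      fix E assume "E \<in> sets \<mu>"
      then have [measurable]: "E \<in> sets borel" by simp
      let ?i = "\<lambda>z. indicator E (fst z) * indicator A (snd z) :: ennreal"
      have "(\<integral>\<^sup>+x. (\<integral>\<^sup>+y. indicator A y \<partial>L x) * indicator E x \<partial>\<mu>)
          = (\<integral>\<^sup>+x. \<integral>\<^sup>+y. ?i (x, y) \<partial>L x \<partial>\<mu>)"
        by (intro nn_integral_cong)
          (simp add: nn_integral_cmult nn_integral_multc markov_transitionD(3)[OF L] mult.commute)
      also have "\<dots> = (\<integral>\<^sup>+z. ?i z \<partial>kernel_product \<mu> L)"
        by (rule nn_integral_kernel_product[OF sets_\<mu> L, symmetric]) measurable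
      also have "\<dots> = (\<integral>\<^sup>+z. f z * ?i z \<partial>kernel_product \<mu> K)"
        unfolding eq by (rule nn_integral_density) measurable
      also have "\<dots> = (\<integral>\<^sup>+x. \<integral>\<^sup>+y. f (x, y) * ?i (x, y) \<partial>K x \<partial>\<mu>)"
        by (rule nn_integral_kernel_product[OF sets_\<mu> K]) measurable
      also have "\<dots> = (\<integral>\<^sup>+x. (\<integral>\<^sup>+y. f (x, y) * indicator A y \<partial>K x) * indicator E x \<partial>\<mu>)"
        by (intro nn_integral_cong, subst nn_integral_multc[symmetric])
          (simp_all add: markov_transitionD(3)[OF K] ac_simps)
      finally show "(\<integral>\<^sup>+x. (\<integral>\<^sup>+y. indicator A y \<partial>L x) * indicator E x \<partial>\<mu>) = \<dots>" .
    qed auto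
    then show ?thesis
      by eventually_elim
        (simp add: emeasure_density markov_transitionD(3)[OF K] markov_transitionD(3)[OF L])
  qed
  obtain G :: "(real^'d) set set" where
    G: "countable G" "Int_stable G" "UNIV \<in> G" "sets borel = sigma_sets UNIV G"
    by (rule countable_intersection_stable_generator)
  have "AE x in \<mu>. \<forall>A\<in>G. emeasure (L x) A = emeasure (density (K x) (\<lambda>y. f (x, y))) A"
    using G(1) G(4) by (intro AE_ball_countable[THEN iffD2] ballI AE_eq) auto
  then show ?thesis
  proof eventually_elim
    case (elim x)
    interpret Lx: prob_space "L x" by (rule markov_transitionD[OF L])
    show ?case
      using elim G markov_transitionD(3)[OF K] markov_transitionD(3)[OF L]
      by (intro measure_eqI_generator_eq[where E = G and \<Omega> = UNIV and A = "\<lambda>_. UNIV"]) auto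
  qed
qed

text \<open>The chain rule for two measures with the same first marginal. The density of one product with
  respect to the other restricts to a density on almost every fibre, and the entropies are integrals
  of the same nonnegative function. The function \<open>h\<close> stands in for the fibrewise entropy because it is
  visibly measurable, being an integral of a jointly measurable function against the transition.\<close>

lemma nn_integral_relative_entropy_transition:
  assumes "prob_space \<mu>" and sets_\<mu> [measurable_cong, simp]: "sets \<mu> = sets borel"
    and K: "markov_transition K" and L: "markov_transition L"
    and finite: "relative_entropy (kernel_product \<mu> L) (kernel_product \<mu> K) < \<top>"
  obtains h where "h \<in> borel_measurable \<mu>" "AE x in \<mu>. relative_entropy (L x) (K x) = h x"
    "(\<integral>\<^sup>+x. h x \<partial>\<mu>) = relative_entropy (kernel_product \<mu> L) (kernel_product \<mu> K)"
proof -
  let ?P = "kernel_product \<mu> K" and ?Q = "kernel_product \<mu> L"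
  note [measurable_cong] = markov_transitionD(3)[OF K] markov_transitionD(3)[OF L]
  have P: "prob_space ?P" and Q: "prob_space ?Q"
    using prob_space_kernel_product assms by blast+
  have sets_P: "sets ?P = sets (borel \<Otimes>\<^sub>M borel)"
    by (rule sets_kernel_product[OF sets_\<mu> K])
  obtain f where f0: "f \<in> borel_measurable ?P" and nn: "\<And>z. 0 \<le> f z"
      and eq: "?Q = density ?P (\<lambda>z. ennreal (f z))"
    using finite_relative_entropy_imp_density[OF P Q finite] by blast
  have f [measurable]: "f \<in> borel_measurable (borel \<Otimes>\<^sub>M borel)"
    using f0 unfolding measurable_cong_sets[OF sets_P refl] .
  define h where "h x = (\<integral>\<^sup>+y. ennreal (entropy_integrand (f (x, y))) \<partial>K x)" for x
  have "AE x in \<mu>. L x = density (K x) (\<lambda>y. ennreal (f (x, y)))"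
    using kernel_product_density_imp_AE_density[OF assms(1,2) K L _ eq] by simp
  then have "AE x in \<mu>. relative_entropy (L x) (K x) = h x"
  proof eventually_elim
    case (elim x)
    have "relative_entropy (density (K x) (\<lambda>y. ennreal (f (x, y)))) (K x) = h x"
      unfolding h_def using nn markov_transitionD(2)[OF K] markov_transitionD(2)[OF L]
      by (intro relative_entropy_density) (auto simp flip: elim)
    with elim show ?case by simp
  qed
  moreover have "h \<in> borel_measurable \<mu>"
    unfolding h_def
    by (rule borel_measurable_nn_integral_transition[OF sets_\<mu> K, of "\<lambda>z. ennreal (entropy_integrand (f z))"])
      measurable
  moreover have "(\<integral>\<^sup>+x. h x \<partial>\<mu>) = relative_entropy ?Q ?P"
  proof -
    have "relative_entropy ?Q ?P = (\<integral>\<^sup>+z. ennreal (entropy_integrand (f z)) \<partial>?P)"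
      unfolding eq using f0 nn Q P by (intro relative_entropy_density) (auto simp flip: eq)
    also have "\<dots> = (\<integral>\<^sup>+x. h x \<partial>\<mu>)"
      unfolding h_def by (rule nn_integral_kernel_product[OF sets_\<mu> K]) measurable
    finally show ?thesis by simp
  qed
  ultimately show ?thesis using that by blast
qed


section \<open>Moments of square integrable random vectors\<close>

lemma bounded_bilinear_outer_product:
  "bounded_bilinear (outer_product :: real^'d \<Rightarrow> real^'d \<Rightarrow> real^'d^'d)"
  unfolding bilinear_conv_bounded_bilinear[symmetric] bilinear_def outer_product_def
  by (auto intro!: linearI simp: vec_eq_iff algebra_simps)

interpretation outer_product:
  bounded_bilinear "outer_product :: real^'d \<Rightarrow> real^'d \<Rightarrow> real^'d^'d"
  by (rule bounded_bilinear_outer_product)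

lemma norm_outer_product: "norm (outer_product v w) = norm v * norm w"
proof -
  have "(norm (outer_product v w))\<^sup>2 = (norm v * norm w)\<^sup>2"
    unfolding power_mult_distrib power2_norm_eq_inner inner_vec_def outer_product_def
    by (simp add: sum_product algebra_simps)
  then show ?thesis
    by (simp add: power2_eq_iff_nonneg)
qed

lemma trace_outer_product: "trace (outer_product v v) = (norm v)\<^sup>2"
  unfolding trace_def outer_product_def power2_norm_eq_inner inner_vec_def by simp

lemma borel_measurable_outer_product [measurable]:
  fixes f g :: "'a \<Rightarrow> real^'d"
  assumes "f \<in> borel_measurable M" "g \<in> borel_measurable M"
  shows "(\<lambda>x. outer_product (f x) (g x)) \<in> borel_measurable M"
  using assms
  by (rule borel_measurable_continuous_Pair) (intro outer_product.continuous_on continuous_intros)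

context prob_space
begin

lemma square_integrable_imp_integrable_norm:
  fixes X :: "'a \<Rightarrow> 'b::{banach, second_countable_topology}"
  assumes [measurable]: "X \<in> borel_measurable M" and "integrable M (\<lambda>x. (norm (X x))\<^sup>2)"
  shows "integrable M X"
proof -
  have "integrable M (\<lambda>x. norm (X x))"
    by (rule square_integrable_imp_integrable) (use assms in auto)
  then show ?thesis by (simp add: integrable_norm_iff)
qed

lemma expectation_square_norm_diff_mean:
  fixes X :: "'a \<Rightarrow> 'b::euclidean_space"
  assumes [measurable]: "X \<in> borel_measurable M" and sq: "integrable M (\<lambda>x. (norm (X x))\<^sup>2)"
  shows "integrable M (\<lambda>x. (norm (X x - expectation X))\<^sup>2)" (is ?integrable)
    and "expectation (\<lambda>x. (norm (X x - expectation X))\<^sup>2)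
      = expectation (\<lambda>x. (norm (X x))\<^sup>2) - (norm (expectation X))\<^sup>2" (is ?eq)
proof -
  let ?m = "expectation X"
  have X: "integrable M X"
    by (rule square_integrable_imp_integrable_norm) fact+
  have expand: "(norm (X x - ?m))\<^sup>2 = (norm (X x))\<^sup>2 - 2 * (X x \<bullet> ?m) + (norm ?m)\<^sup>2" for x
    by (simp add: power2_norm_eq_inner algebra_simps inner_commute)
  show ?integrable
    unfolding expand using sq X by auto
  have "expectation (\<lambda>x. X x \<bullet> ?m) = (norm ?m)\<^sup>2"
    using X by (simp add: power2_norm_eq_inner)
  then show ?eq
    unfolding expand using sq X by (simp add: prob_space)
qed

lemma square_norm_expectation_le:
  fixes X :: "'a \<Rightarrow> 'b::euclidean_space"
  assumes [measurable]: "X \<in> borel_measurable M" and sq: "integrable M (\<lambda>x. (norm (X x))\<^sup>2)"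
  shows "(norm (expectation X))\<^sup>2 \<le> expectation (\<lambda>x. (norm (X x))\<^sup>2)"
proof -
  have "0 \<le> expectation (\<lambda>x. (norm (X x - expectation X))\<^sup>2)"
    by (rule Bochner_Integration.integral_nonneg) simp
  with expectation_square_norm_diff_mean(2)[OF assms] show ?thesis by simp
qed

lemma expectation_mult_norm_le:
  fixes X Y :: "'a \<Rightarrow> 'b::euclidean_space"
  assumes [measurable]: "X \<in> borel_measurable M" "Y \<in> borel_measurable M"
    and X: "integrable M (\<lambda>x. (norm (X x))\<^sup>2)" and Y: "integrable M (\<lambda>x. (norm (Y x))\<^sup>2)"
  shows "integrable M (\<lambda>x. norm (X x) * norm (Y x))"
    and "expectation (\<lambda>x. norm (X x) * norm (Y x))
      \<le> sqrt (expectation (\<lambda>x. (norm (X x))\<^sup>2)) * sqrt (expectation (\<lambda>x. (norm (Y x))\<^sup>2))"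
proof -
  show int: "integrable M (\<lambda>x. norm (X x) * norm (Y x))"
  proof (rule Bochner_Integration.integrable_bound[OF Bochner_Integration.integrable_add[OF X Y]])
    have "norm (X x) * norm (Y x) \<le> (norm (X x))\<^sup>2 + (norm (Y x))\<^sup>2" for x
      using sum_squares_bound[of "norm (X x)" "norm (Y x)"]
        mult_nonneg_nonneg[OF norm_ge_zero[of "X x"] norm_ge_zero[of "Y x"]] by linarith
    then show "AE x in M. norm (norm (X x) * norm (Y x)) \<le> norm ((norm (X x))\<^sup>2 + (norm (Y x))\<^sup>2)"
      by auto
  qed measurable
  have "(\<integral>\<^sup>+x. ennreal (norm (X x)) * ennreal (norm (Y x)) \<partial>M)\<^sup>2
      \<le> (\<integral>\<^sup>+x. (ennreal (norm (X x)))\<^sup>2 \<partial>M) * (\<integral>\<^sup>+x. (ennreal (norm (Y x)))\<^sup>2 \<partial>M)"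
    by (rule Cauchy_Schwarz_nn_integral) measurable
  then have "ennreal ((expectation (\<lambda>x. norm (X x) * norm (Y x)))\<^sup>2)
      \<le> ennreal (expectation (\<lambda>x. (norm (X x))\<^sup>2) * expectation (\<lambda>x. (norm (Y x))\<^sup>2))"
    using int X Y
    by (simp add: ennreal_mult[symmetric] ennreal_power nn_integral_eq_integral)
  then have "(expectation (\<lambda>x. norm (X x) * norm (Y x)))\<^sup>2
      \<le> expectation (\<lambda>x. (norm (X x))\<^sup>2) * expectation (\<lambda>x. (norm (Y x))\<^sup>2)"
    by (subst (asm) ennreal_le_iff) auto
  then show "expectation (\<lambda>x. norm (X x) * norm (Y x))
      \<le> sqrt (expectation (\<lambda>x. (norm (X x))\<^sup>2)) * sqrt (expectation (\<lambda>x. (norm (Y x))\<^sup>2))"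
    by (simp add: real_le_rsqrt real_sqrt_mult[symmetric])
qed

text \<open>With \<open>D = Z' - Y'\<close> one has \<open>Z' \<otimes> Z' - Y' \<otimes> Y' = D \<otimes> D + D \<otimes> Y' + Y' \<otimes> D\<close>. Moreover \<open>D\<close> is
  the centred version of \<open>Z - Y\<close>, so that the mean of \<open>\<parallel>D\<parallel>\<^sup>2\<close> is at most \<open>c\<close>.\<close>

lemma norm_covariance_diff_le:
  fixes Y Z :: "'a \<Rightarrow> real^'d"
  assumes [measurable]: "Y \<in> borel_measurable M" "Z \<in> borel_measurable M"
    and Y: "integrable M (\<lambda>x. (norm (Y x))\<^sup>2)" and Z: "integrable M (\<lambda>x. (norm (Z x))\<^sup>2)"
    and D: "integrable M (\<lambda>x. (norm (Z x - Y x))\<^sup>2)"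
  defines "Y' \<equiv> \<lambda>x. Y x - expectation Y" and "Z' \<equiv> \<lambda>x. Z x - expectation Z"
    and "c \<equiv> expectation (\<lambda>x. (norm (Z x - Y x))\<^sup>2)"
  shows "norm (expectation (\<lambda>x. outer_product (Z' x) (Z' x))
        - expectation (\<lambda>x. outer_product (Y' x) (Y' x)))
      \<le> c + 2 * sqrt c * sqrt (expectation (\<lambda>x. (norm (Y' x))\<^sup>2))"
proof -
  let ?s = "sqrt (expectation (\<lambda>x. (norm (Y' x))\<^sup>2))"
  define D' where "D' x = Z' x - Y' x" for x
  have [measurable]: "Y' \<in> borel_measurable M" "Z' \<in> borel_measurable M" "D' \<in> borel_measurable M"
    unfolding Y'_def Z'_def D'_def by measurable
  have Y'_sq: "integrable M (\<lambda>x. (norm (Y' x))\<^sup>2)" and Z'_sq: "integrable M (\<lambda>x. (norm (Z' x))\<^sup>2)"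
    unfolding Y'_def Z'_def by (intro expectation_square_norm_diff_mean; fact)+
  have "integrable M Y" "integrable M Z"
    using Y Z by (auto intro: square_integrable_imp_integrable_norm)
  then have D'_eq: "D' = (\<lambda>x. (Z x - Y x) - expectation (\<lambda>x. Z x - Y x))"
    by (auto simp: fun_eq_iff D'_def Y'_def Z'_def)
  have D'_sq: "integrable M (\<lambda>x. (norm (D' x))\<^sup>2)"
    unfolding D'_eq using D by (intro expectation_square_norm_diff_mean) measurable
  have D'_le: "expectation (\<lambda>x. (norm (D' x))\<^sup>2) \<le> c"
    unfolding D'_eq c_def using D by (subst expectation_square_norm_diff_mean) auto
  have outer: "integrable M (\<lambda>x. outer_product (V x) (V x))"
    if [measurable]: "V \<in> borel_measurable M" and "integrable M (\<lambda>x. (norm (V x))\<^sup>2)"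
    for V :: "'a \<Rightarrow> real^'d"
    by (rule Bochner_Integration.integrable_bound[OF that(2)])
      (auto simp: norm_outer_product power2_eq_square)
  note DY = expectation_mult_norm_le[OF _ _ D'_sq Y'_sq]
  have "norm (expectation (\<lambda>x. outer_product (Z' x) (Z' x))
        - expectation (\<lambda>x. outer_product (Y' x) (Y' x)))
      = norm (expectation (\<lambda>x. outer_product (Z' x) (Z' x) - outer_product (Y' x) (Y' x)))"
    using outer Y'_sq Z'_sq by simp
  also have "\<dots> \<le> expectation (\<lambda>x. norm (outer_product (Z' x) (Z' x) - outer_product (Y' x) (Y' x)))"
    by (rule integral_norm_bound)
  also have "\<dots> \<le> expectation (\<lambda>x. (norm (D' x))\<^sup>2 + 2 * (norm (D' x) * norm (Y' x)))"
  proof (rule integral_mono)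
    show "integrable M (\<lambda>x. norm (outer_product (Z' x) (Z' x) - outer_product (Y' x) (Y' x)))"
      using outer Y'_sq Z'_sq by auto
    show "integrable M (\<lambda>x. (norm (D' x))\<^sup>2 + 2 * (norm (D' x) * norm (Y' x)))"
      using D'_sq DY(1) by auto
  next
    fix x
    have "outer_product (Z' x) (Z' x) - outer_product (Y' x) (Y' x)
        = outer_product (D' x) (D' x) + (outer_product (D' x) (Y' x) + outer_product (Y' x) (D' x))"
      by (simp add: D'_def outer_product.diff_left outer_product.diff_right)
    also have "norm \<dots> \<le> norm (outer_product (D' x) (D' x))
        + (norm (outer_product (D' x) (Y' x)) + norm (outer_product (Y' x) (D' x)))"
      by (intro norm_triangle_le add_left_mono norm_triangle_ineq)
    finally show "norm (outer_product (Z' x) (Z' x) - outer_product (Y' x) (Y' x))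
        \<le> (norm (D' x))\<^sup>2 + 2 * (norm (D' x) * norm (Y' x))"
      by (simp add: norm_outer_product power2_eq_square mult.commute)
  qed
  also have "\<dots> = expectation (\<lambda>x. (norm (D' x))\<^sup>2)
      + 2 * expectation (\<lambda>x. norm (D' x) * norm (Y' x))"
    using D'_sq DY(1) by simp
  also have "\<dots> \<le> c + 2 * (sqrt c * ?s)"
  proof -
    have "expectation (\<lambda>x. norm (D' x) * norm (Y' x))
        \<le> sqrt (expectation (\<lambda>x. (norm (D' x))\<^sup>2)) * ?s"
      by (rule DY(2)) measurable
    also have "\<dots> \<le> sqrt c * ?s"
      using D'_le by (intro mult_right_mono) auto
    finally show ?thesis using D'_le by simp
  qed
  finally show ?thesis by simp
qed

end


section \<open>Transportation inequalities and couplings\<close>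

lemma quadratic_transport_wasserstein2_le:
  assumes "quadratic_transport \<rho> M" "prob_space N" "sets N = sets borel"
  shows "(wasserstein2 N M)\<^sup>2 \<le> ennreal (2 * \<rho>) * relative_entropy N M"
proof -
  have "ennreal 2 * (ennreal (1 / 2) * (wasserstein2 N M)\<^sup>2)
      \<le> ennreal 2 * (ennreal \<rho> * relative_entropy N M)"
    using assms unfolding quadratic_transport_def by (intro mult_left_mono) auto
  moreover have "ennreal 2 * (ennreal (1 / 2) * x) = x" for x
  proof -
    have "ennreal 2 * ennreal (1 / 2) = 1"
      by (subst ennreal_mult[symmetric]) auto
    then show ?thesis
      by (simp only: mult.assoc[symmetric] mult_1_left)
  qed
  moreover have "ennreal 2 * (ennreal \<rho> * x) = ennreal (2 * \<rho>) * x" for x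
    by (cases "0 \<le> \<rho>") (auto simp: mult.assoc[symmetric] ennreal_mult ennreal_neg)
  ultimately show ?thesis by simp
qed

text \<open>The inequality is applied to \<open>M\<close> conditioned on a ball of positive mass. Its density is bounded, hence
  its entropy is finite, hence some coupling with \<open>M\<close> has finite quadratic cost; as the conditioned
  measure has bounded support, the second moment of \<open>M\<close> is finite.\<close>

lemma quadratic_transport_imp_square_integrable:
  fixes M :: "(real^'d) measure"
  assumes "prob_space M" and sets_M [measurable_cong]: "sets M = sets borel"
    and T2: "quadratic_transport \<rho> M"
  shows "integrable M (\<lambda>y. (norm y)\<^sup>2)"
proof -
  interpret M: prob_space M by fact
  have space_M: "space M = UNIV"
    using sets_eq_imp_space_eq[OF sets_M] by simp
  obtain R where R: "emeasure M (cball 0 (real R)) \<noteq> 0"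
  proof (rule ccontr)
    assume "\<not> thesis"
    with that have "emeasure M (cball 0 (real n)) = 0" for n
      by blast
    then have "emeasure M (\<Union>n. cball 0 (real n)) = 0"
      by (intro emeasure_UN_eq_0) (auto simp: sets_M)
    moreover have "(\<Union>n. cball (0 :: real^'d) (real n)) = space M"
      using real_arch_simple by (auto simp: space_M)
    ultimately show False
      using M.emeasure_space_1 by simp
  qed
  define p where "p = measure M (cball 0 (real R))"
  define f where "f y = indicator (cball 0 (real R)) y / p" for y :: "real^'d"
  define N where "N = density M (\<lambda>y. ennreal (f y))"
  have [measurable]: "f \<in> borel_measurable borel"
    unfolding f_def by (intro borel_measurable_divide borel_measurable_indicator) auto
  have "0 < p"
    using R by (simp add: p_def M.emeasure_eq_measure zero_less_measure_iff)
  then have f_nonneg: "0 \<le> f y" for y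
    by (simp add: f_def)
  have "(\<integral>\<^sup>+y. ennreal (f y) \<partial>M) = (\<integral>\<^sup>+y. ennreal (1 / p) * indicator (cball 0 (real R)) y \<partial>M)"
    by (intro nn_integral_cong) (auto simp: f_def indicator_def)
  also have "\<dots> = ennreal (1 / p) * emeasure M (cball 0 (real R))"
    by (rule nn_integral_cmult_indicator) (simp add: sets_M)
  also have "\<dots> = 1"
    using \<open>0 < p\<close> by (simp add: M.emeasure_eq_measure p_def[symmetric] ennreal_mult[symmetric])
  finally have N: "prob_space N"
    by (intro prob_spaceI) (simp add: N_def emeasure_density cong: nn_integral_cong)
  have sets_N: "sets N = sets borel"
    by (simp add: N_def sets_M)
  have "relative_entropy N M = (\<integral>\<^sup>+y. ennreal (entropy_integrand (f y)) \<partial>M)"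
    using N f_nonneg unfolding N_def
    by (intro relative_entropy_density \<open>prob_space M\<close>) measurable
  also have "\<dots> \<le> (\<integral>\<^sup>+y. ennreal (entropy_integrand (1 / p) + 1) \<partial>M)"
  proof (intro nn_integral_mono ennreal_leI)
    fix y
    have "0 \<le> entropy_integrand (1 / p)"
      using \<open>0 < p\<close> by (intro entropy_integrand_nonneg) simp
    then show "entropy_integrand (f y) \<le> entropy_integrand (1 / p) + 1"
      by (cases "y \<in> cball 0 (real R)") (auto simp: f_def entropy_integrand_def)
  qed
  also have "\<dots> < \<top>"
    by (simp add: M.emeasure_space_1)
  finally have "(wasserstein2 N M)\<^sup>2 < \<top>"
    using quadratic_transport_wasserstein2_le[OF T2 N sets_N]
    by (auto simp: ennreal_mult_less_top intro: le_less_trans)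
  then obtain Q where Q: "Q \<in> couplings N M"
      and cost: "(\<integral>\<^sup>+z. ennreal ((norm (fst z - snd z))\<^sup>2) \<partial>Q) < \<top>"
    by (auto simp: wasserstein2_def ennreal_sqrt_power2 INF_less_iff)
  have marginals: "distr Q borel fst = N" "distr Q borel snd = M"
    and sets_Q [measurable_cong]: "sets Q = sets (borel \<Otimes>\<^sub>M borel)"
    using Q by (auto simp: couplings_def)
  have "(\<integral>\<^sup>+y. ennreal ((norm y)\<^sup>2) \<partial>N) = (\<integral>\<^sup>+y. ennreal (f y) * ennreal ((norm y)\<^sup>2) \<partial>M)"
    unfolding N_def by (rule nn_integral_density) measurable
  also have "\<dots> \<le> (\<integral>\<^sup>+y. ennreal ((real R)\<^sup>2 / p) \<partial>M)"
    using \<open>0 < p\<close>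
    by (intro nn_integral_mono)
      (auto simp: f_def indicator_def ennreal_mult[symmetric] divide_right_mono intro!: ennreal_leI)
  also have "\<dots> < \<top>"
    by (simp add: M.emeasure_space_1)
  finally have moment_N: "(\<integral>\<^sup>+y. ennreal ((norm y)\<^sup>2) \<partial>N) < \<top>" .
  have "(\<integral>\<^sup>+y. ennreal ((norm y)\<^sup>2) \<partial>M) = (\<integral>\<^sup>+z. ennreal ((norm (snd z))\<^sup>2) \<partial>Q)"
    unfolding marginals(2)[symmetric] by (subst nn_integral_distr) measurable
  also have "\<dots> \<le> (\<integral>\<^sup>+z. 2 * ennreal ((norm (fst z - snd z))\<^sup>2) + 2 * ennreal ((norm (fst z))\<^sup>2) \<partial>Q)"
  proof (rule nn_integral_mono)
    fix z :: "(real^'d) \<times> (real^'d)"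
    have "(norm (snd z))\<^sup>2 \<le> (norm (fst z - snd z) + norm (fst z))\<^sup>2"
      using norm_triangle_ineq4[of "fst z" "fst z - snd z"] by (intro power_mono) auto
    also have "\<dots> \<le> 2 * (norm (fst z - snd z))\<^sup>2 + 2 * (norm (fst z))\<^sup>2"
      using sum_squares_bound[of "norm (fst z - snd z)" "norm (fst z)"] by (simp add: power2_sum)
    finally have "ennreal ((norm (snd z))\<^sup>2)
        \<le> ennreal (2 * (norm (fst z - snd z))\<^sup>2 + 2 * (norm (fst z))\<^sup>2)"
      by (rule ennreal_leI)
    then show "ennreal ((norm (snd z))\<^sup>2)
        \<le> 2 * ennreal ((norm (fst z - snd z))\<^sup>2) + 2 * ennreal ((norm (fst z))\<^sup>2)"
      by (simp add: ennreal_mult)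
  qed
  also have "\<dots> = 2 * (\<integral>\<^sup>+z. ennreal ((norm (fst z - snd z))\<^sup>2) \<partial>Q)
      + 2 * (\<integral>\<^sup>+z. ennreal ((norm (fst z))\<^sup>2) \<partial>Q)"
    by (simp add: nn_integral_add nn_integral_cmult)
  also have "(\<integral>\<^sup>+z. ennreal ((norm (fst z))\<^sup>2) \<partial>Q) = (\<integral>\<^sup>+y. ennreal ((norm y)\<^sup>2) \<partial>N)"
    unfolding marginals(1)[symmetric] by (subst nn_integral_distr) measurable
  also have "2 * (\<integral>\<^sup>+z. ennreal ((norm (fst z - snd z))\<^sup>2) \<partial>Q)
      + 2 * (\<integral>\<^sup>+y. ennreal ((norm y)\<^sup>2) \<partial>N) < \<top>"
    using cost moment_N by (simp add: ennreal_mult_less_top)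
  finally show ?thesis
    by (simp add: integrable_iff_bounded)
qed

lemma trace_kernel_covariance:
  fixes L :: "real^'d \<Rightarrow> (real^'d) measure"
  assumes "prob_space (L x)" and sets_L [measurable_cong]: "sets (L x) = sets borel"
    and sq: "integrable (L x) (\<lambda>y. (norm y)\<^sup>2)"
  shows "integrable (L x) (\<lambda>y. (norm (y - kernel_mean L x))\<^sup>2)"
    and "trace (kernel_covariance L x) = (\<integral>y. (norm (y - kernel_mean L x))\<^sup>2 \<partial>L x)"
proof -
  interpret prob_space "L x" by fact
  show int: "integrable (L x) (\<lambda>y. (norm (y - kernel_mean L x))\<^sup>2)"
    unfolding kernel_mean_def using sq by (intro expectation_square_norm_diff_mean) measurable
  have linear: "bounded_linear (trace :: real^'d^'d \<Rightarrow> real)"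
    unfolding linear_conv_bounded_linear[symmetric]
    by (auto intro!: linearI simp: trace_def sum.distrib sum_distrib_left)
  have "integrable (L x) (\<lambda>y. outer_product (y - kernel_mean L x) (y - kernel_mean L x))"
    by (rule Bochner_Integration.integrable_bound[OF int])
      (auto simp: norm_outer_product power2_eq_square)
  from integral_bounded_linear[OF linear this]
  show "trace (kernel_covariance L x) = (\<integral>y. (norm (y - kernel_mean L x))\<^sup>2 \<partial>L x)"
    by (simp add: kernel_covariance_def trace_outer_product)
qed

text \<open>Under \<open>Q\<close> the two coordinates are random vectors with laws \<open>L x\<close> and \<open>K x\<close> on a common
  probability space, so that their moments can be compared there.\<close>

lemma coupling_moment_bounds:
  fixes K L :: "real^'d \<Rightarrow> (real^'d) measure"
  assumes Q: "Q \<in> couplings (L x) (K x)"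
    and sets_L: "sets (L x) = sets borel" and sets_K: "sets (K x) = sets borel"
    and L: "integrable (L x) (\<lambda>y. (norm y)\<^sup>2)" and K: "integrable (K x) (\<lambda>y. (norm y)\<^sup>2)"
  defines "c \<equiv> (\<integral>z. (norm (fst z - snd z))\<^sup>2 \<partial>Q)"
  shows "(\<integral>\<^sup>+z. ennreal ((norm (fst z - snd z))\<^sup>2) \<partial>Q) = ennreal c"
    and "0 \<le> c"
    and "(norm (kernel_mean K x - kernel_mean L x))\<^sup>2 \<le> c"
    and "norm (kernel_covariance K x - kernel_covariance L x)
      \<le> c + 2 * sqrt c * sqrt (trace (kernel_covariance L x))"
proof -
  have "prob_space Q" and marginals: "distr Q borel fst = L x" "distr Q borel snd = K x"
    and sets_Q [measurable_cong]: "sets Q = sets (borel \<Otimes>\<^sub>M borel)"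
    using Q by (auto simp: couplings_def)
  then interpret Q: prob_space Q by simp
  have Y: "integrable Q (\<lambda>z. (norm (fst z))\<^sup>2)"
    using L unfolding marginals(1)[symmetric] by (subst (asm) integrable_distr_eq) auto
  have Z: "integrable Q (\<lambda>z. (norm (snd z))\<^sup>2)"
    using K unfolding marginals(2)[symmetric] by (subst (asm) integrable_distr_eq) auto
  have D: "integrable Q (\<lambda>z. (norm (snd z - fst z))\<^sup>2)"
  proof -
    have "integrable Q (\<lambda>z. (norm (snd z))\<^sup>2 - 2 * (snd z \<bullet> fst z) + (norm (fst z))\<^sup>2)"
    proof -
      have "integrable Q (\<lambda>z. snd z \<bullet> fst z)"
        by (rule Bochner_Integration.integrable_bound[OF Q.expectation_mult_norm_le(1)[OF _ _ Z Y]])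
          (auto simp: Cauchy_Schwarz_ineq2)
      with Y Z show ?thesis by auto
    qed
    then show ?thesis
      by (simp add: power2_norm_eq_inner algebra_simps inner_commute)
  qed
  have c: "c = Q.expectation (\<lambda>z. (norm (snd z - fst z))\<^sup>2)"
    by (simp add: c_def norm_minus_commute)
  show "(\<integral>\<^sup>+z. ennreal ((norm (fst z - snd z))\<^sup>2) \<partial>Q) = ennreal c"
    using D by (simp add: c_def norm_minus_commute nn_integral_eq_integral)
  show "0 \<le> c"
    unfolding c_def by (rule Bochner_Integration.integral_nonneg) simp
  have mean_L: "kernel_mean L x = Q.expectation fst"
    unfolding kernel_mean_def marginals(1)[symmetric] by (subst integral_distr) auto
  have mean_K: "kernel_mean K x = Q.expectation snd"
    unfolding kernel_mean_def marginals(2)[symmetric] by (subst integral_distr) auto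
  have int: "integrable Q fst" "integrable Q snd"
    using Y Z by (auto intro!: Q.square_integrable_imp_integrable_norm)
  show "(norm (kernel_mean K x - kernel_mean L x))\<^sup>2 \<le> c"
    using Q.square_norm_expectation_le[OF _ D] int by (simp add: mean_L mean_K c)
  have cov_L: "kernel_covariance L x =
      Q.expectation (\<lambda>z. outer_product (fst z - Q.expectation fst) (fst z - Q.expectation fst))"
    unfolding kernel_covariance_def mean_L by (subst marginals(1)[symmetric], subst integral_distr) auto
  have cov_K: "kernel_covariance K x =
      Q.expectation (\<lambda>z. outer_product (snd z - Q.expectation snd) (snd z - Q.expectation snd))"
    unfolding kernel_covariance_def mean_K by (subst marginals(2)[symmetric], subst integral_distr) auto
  have "trace (kernel_covariance L x) = Q.expectation (\<lambda>z. (norm (fst z - Q.expectation fst))\<^sup>2)"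
  proof -
    have "prob_space (L x)"
      unfolding marginals(1)[symmetric] by (rule Q.prob_space_distr) measurable
    then have "trace (kernel_covariance L x) = (\<integral>y. (norm (y - Q.expectation fst))\<^sup>2 \<partial>L x)"
      using sets_L L by (simp add: trace_kernel_covariance(2) mean_L)
    also have "\<dots> = Q.expectation (\<lambda>z. (norm (fst z - Q.expectation fst))\<^sup>2)"
      by (subst marginals(1)[symmetric], subst integral_distr) auto
    finally show ?thesis .
  qed
  then show "norm (kernel_covariance K x - kernel_covariance L x)
      \<le> c + 2 * sqrt c * sqrt (trace (kernel_covariance L x))"
    using Q.norm_covariance_diff_le[OF _ _ Y Z D] by (simp add: cov_L cov_K c)
qed

text \<open>The bounds of \<open>coupling_moment_bounds\<close> hold for every coupling, and are transferred to the squared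
  Wasserstein distance by taking the infimum over the couplings.\<close>

lemma quadratic_transport_moment_bounds:
  fixes K L :: "real^'d \<Rightarrow> (real^'d) measure"
  assumes "0 < \<rho>"
    and "prob_space (L x)" "sets (L x) = sets borel" "quadratic_transport \<rho> (L x)"
    and "prob_space (K x)" "sets (K x) = sets borel" "quadratic_transport \<rho> (K x)"
  defines "H \<equiv> relative_entropy (L x) (K x)"
  shows "ennreal ((norm (kernel_mean K x - kernel_mean L x))\<^sup>2) \<le> ennreal (2 * \<rho>) * H"
    and "ennreal (norm (kernel_covariance K x - kernel_covariance L x))
      \<le> ennreal (2 * \<rho>) * H
        + ennreal_sqrt (ennreal (8 * \<rho>) * H) * ennreal_sqrt (ennreal (trace (kernel_covariance L x)))"
proof -
  have sq_L: "integrable (L x) (\<lambda>y. (norm y)\<^sup>2)" and sq_K: "integrable (K x) (\<lambda>y. (norm y)\<^sup>2)"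
    by (rule quadratic_transport_imp_square_integrable; fact)+
  note bounds = coupling_moment_bounds[where K = K and L = L and x = x, OF _ assms(3,6) sq_L sq_K]
  have trace_nonneg: "0 \<le> trace (kernel_covariance L x)"
    using assms sq_L by (subst trace_kernel_covariance) auto
  have transport: "r \<le> ennreal (2 * \<rho>) * H"
    if "\<And>Q. Q \<in> couplings (L x) (K x) \<Longrightarrow> r \<le> (\<integral>\<^sup>+z. ennreal ((norm (fst z - snd z))\<^sup>2) \<partial>Q)" for r
  proof -
    have "r \<le> (wasserstein2 (L x) (K x))\<^sup>2"
      unfolding wasserstein2_def ennreal_sqrt_power2 using that by (rule INF_greatest)
    also have "\<dots> \<le> ennreal (2 * \<rho>) * H"
      unfolding H_def by (rule quadratic_transport_wasserstein2_le; fact)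
    finally show ?thesis .
  qed
  show "ennreal ((norm (kernel_mean K x - kernel_mean L x))\<^sup>2) \<le> ennreal (2 * \<rho>) * H"
  proof (rule transport)
    fix Q assume "Q \<in> couplings (L x) (K x)"
    note bounds[OF this]
    then show "ennreal ((norm (kernel_mean K x - kernel_mean L x))\<^sup>2)
        \<le> (\<integral>\<^sup>+z. ennreal ((norm (fst z - snd z))\<^sup>2) \<partial>Q)"
      by (simp add: ennreal_leI)
  qed
  let ?n = "norm (kernel_covariance K x - kernel_covariance L x)"
    and ?s = "sqrt (trace (kernel_covariance L x))"
  have s: "0 \<le> ?s"
    using trace_nonneg by simp
  have s_le: "?s \<le> sqrt (?n + ?s\<^sup>2)"
    by (rule real_le_rsqrt) simp
  \<comment> \<open>The inequality \<open>n \<le> c + 2 \<surd>c s\<close> is solved for \<open>c\<close>, so that the infimum over the couplings can be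
    taken without a continuity argument: completing the square gives \<open>(\<surd>(n + s\<^sup>2) - s)\<^sup>2 \<le> c\<close>.\<close>
  have "ennreal ((sqrt (?n + ?s\<^sup>2) - ?s)\<^sup>2) \<le> ennreal (2 * \<rho>) * H"
  proof (rule transport)
    fix Q assume Q: "Q \<in> couplings (L x) (K x)"
    define c where "c = (\<integral>z. (norm (fst z - snd z))\<^sup>2 \<partial>Q)"
    have c: "(\<integral>\<^sup>+z. ennreal ((norm (fst z - snd z))\<^sup>2) \<partial>Q) = ennreal c" "0 \<le> c"
        "?n \<le> c + 2 * sqrt c * ?s"
      using bounds[OF Q] by (simp_all add: c_def)
    have "?n + ?s\<^sup>2 \<le> (sqrt c + ?s)\<^sup>2"
      using c(2,3) by (simp add: power2_sum)
    then have "sqrt (?n + ?s\<^sup>2) \<le> sqrt c + ?s"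
      using c(2) s by (intro real_le_lsqrt) auto
    then have "(sqrt (?n + ?s\<^sup>2) - ?s)\<^sup>2 \<le> (sqrt c)\<^sup>2"
      using s_le by (intro power_mono) auto
    then show "ennreal ((sqrt (?n + ?s\<^sup>2) - ?s)\<^sup>2)
        \<le> (\<integral>\<^sup>+z. ennreal ((norm (fst z - snd z))\<^sup>2) \<partial>Q)"
      using c(1,2) by (simp add: ennreal_leI)
  qed
  then show "ennreal ?n \<le> ennreal (2 * \<rho>) * H
      + ennreal_sqrt (ennreal (8 * \<rho>) * H) * ennreal_sqrt (ennreal (trace (kernel_covariance L x)))"
  proof (cases H)
    case (real h)
    let ?c = "2 * \<rho> * h"
    have c: "0 \<le> ?c"
      using real \<open>0 < \<rho>\<close> by simp
    assume "ennreal ((sqrt (?n + ?s\<^sup>2) - ?s)\<^sup>2) \<le> ennreal (2 * \<rho>) * H"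
    then have "(sqrt (?n + ?s\<^sup>2) - ?s)\<^sup>2 \<le> ?c"
      using real \<open>0 < \<rho>\<close> by (simp add: ennreal_mult[symmetric])
    then have "sqrt (?n + ?s\<^sup>2) - ?s \<le> sqrt ?c"
      by (rule real_le_rsqrt)
    then have "(sqrt (?n + ?s\<^sup>2))\<^sup>2 \<le> (sqrt ?c + ?s)\<^sup>2"
      by (intro power_mono) auto
    then have "?n \<le> ?c + 2 * sqrt ?c * ?s"
      using c by (simp add: power2_sum)
    also have "2 * sqrt ?c = sqrt (8 * \<rho> * h)"
      using real_sqrt_mult[of 4 ?c] by (simp add: algebra_simps)
    finally have "ennreal ?n \<le> ennreal (?c + sqrt (8 * \<rho> * h) * ?s)"
      by (rule ennreal_leI)
    then show ?thesis
      using real \<open>0 < \<rho>\<close> c s trace_nonneg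
      by (simp add: ennreal_mult[symmetric] ennreal_plus[symmetric] ennreal_sqrt_ennreal del: ennreal_plus)
  next
    case top
    with \<open>0 < \<rho>\<close> show ?thesis by (simp add: ennreal_mult_top)
  qed
qed


section \<open>Moments of bridge transitions\<close>

text \<open>The pointwise bounds are integrated over \<open>\<mu>\<close> by the chain rule; the mixed term of the covariance
  bound is a product of two square roots, to which the Cauchy--Schwarz inequality applies.\<close>

lemma kernel_product_moment_bounds:
  fixes K L :: "real^'d \<Rightarrow> (real^'d) measure"
  assumes "prob_space \<mu>" and sets_\<mu> [measurable_cong, simp]: "sets \<mu> = sets borel"
    and K: "markov_transition K" and L: "markov_transition L"
    and "0 < \<rho>"
    and T2_L: "\<And>x. quadratic_transport \<rho> (L x)" and T2_K: "\<And>x. quadratic_transport \<rho> (K x)"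
  defines "H \<equiv> relative_entropy (kernel_product \<mu> L) (kernel_product \<mu> K)"
  shows "lp_norm_pow 2 \<mu> (\<lambda>x. kernel_mean K x - kernel_mean L x) \<le> ennreal (2 * \<rho>) * H"
    and "lp_norm_pow 1 \<mu> (\<lambda>x. kernel_covariance K x - kernel_covariance L x)
      \<le> ennreal (2 * \<rho>) * H + bridge_spread \<mu> L * ennreal_sqrt (ennreal (8 * \<rho>) * H)"
proof -
  have "lp_norm_pow 2 \<mu> (\<lambda>x. kernel_mean K x - kernel_mean L x) \<le> ennreal (2 * \<rho>) * H \<and>
    lp_norm_pow 1 \<mu> (\<lambda>x. kernel_covariance K x - kernel_covariance L x)
      \<le> ennreal (2 * \<rho>) * H + bridge_spread \<mu> L * ennreal_sqrt (ennreal (8 * \<rho>) * H)"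
  proof (cases "H < \<top>")
    case False
    with \<open>0 < \<rho>\<close> show ?thesis
      by (simp add: not_less top_unique ennreal_mult_top)
  next
    case True
    then obtain h where [measurable]: "h \<in> borel_measurable \<mu>"
        and h: "AE x in \<mu>. relative_entropy (L x) (K x) = h x"
        and int_h: "(\<integral>\<^sup>+x. h x \<partial>\<mu>) = H"
      using nn_integral_relative_entropy_transition[OF assms(1,2) K L] unfolding H_def by blast
    note bounds = quadratic_transport_moment_bounds[where K = K and L = L, OF \<open>0 < \<rho>\<close>
        markov_transitionD(2,3)[OF L] T2_L markov_transitionD(2,3)[OF K] T2_K]
    let ?tr = "\<lambda>x. ennreal (trace (kernel_covariance L x))"
    have [measurable]: "?tr \<in> borel_measurable \<mu>"
    proof -
      note [measurable] = markov_transitionD(1)[OF L]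
      have [measurable]: "kernel_mean L \<in> borel_measurable borel"
        unfolding kernel_mean_def by measurable
      have "?tr x = (\<integral>\<^sup>+y. ennreal ((norm (y - kernel_mean L x))\<^sup>2) \<partial>L x)" for x
      proof -
        note L_x = markov_transitionD(2,3)[OF L]
        have "integrable (L x) (\<lambda>y. (norm y)\<^sup>2)"
          by (rule quadratic_transport_imp_square_integrable[OF L_x T2_L])
        from trace_kernel_covariance[where L = L and x = x, OF L_x this] show ?thesis
          by (simp add: nn_integral_eq_integral)
      qed
      then show ?thesis
        using borel_measurable_nn_integral_transition[OF sets_\<mu> L,
            of "\<lambda>z. ennreal ((norm (snd z - kernel_mean L (fst z)))\<^sup>2)"] by simp
    qed
    have mean: "lp_norm_pow 2 \<mu> (\<lambda>x. kernel_mean K x - kernel_mean L x) \<le> ennreal (2 * \<rho>) * H"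
    proof -
      have "lp_norm_pow 2 \<mu> (\<lambda>x. kernel_mean K x - kernel_mean L x)
          \<le> (\<integral>\<^sup>+x. ennreal (2 * \<rho>) * h x \<partial>\<mu>)"
        unfolding lp_norm_pow_def
        using h by (intro nn_integral_mono_AE, eventually_elim) (use bounds(1) in metis)
      also have "\<dots> = ennreal (2 * \<rho>) * H"
        by (simp add: nn_integral_cmult int_h)
      finally show ?thesis .
    qed
    let ?e = "\<lambda>x. ennreal_sqrt (ennreal (8 * \<rho>) * h x)" and ?s = "\<lambda>x. ennreal_sqrt (?tr x)"
    have "(\<integral>\<^sup>+x. ?e x * ?s x \<partial>\<mu>)\<^sup>2 \<le> (\<integral>\<^sup>+x. (?e x)\<^sup>2 \<partial>\<mu>) * (\<integral>\<^sup>+x. (?s x)\<^sup>2 \<partial>\<mu>)"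
      by (rule Cauchy_Schwarz_nn_integral) measurable
    also have "\<dots> = (\<integral>\<^sup>+x. ?tr x \<partial>\<mu>) * (ennreal (8 * \<rho>) * H)"
      by (simp add: ennreal_sqrt_power2 nn_integral_cmult int_h) (rule mult.commute)
    finally have cross: "(\<integral>\<^sup>+x. ?e x * ?s x \<partial>\<mu>)
        \<le> bridge_spread \<mu> L * ennreal_sqrt (ennreal (8 * \<rho>) * H)"
      unfolding bridge_spread_def by (rule le_ennreal_sqrt_mult)
    have "lp_norm_pow 1 \<mu> (\<lambda>x. kernel_covariance K x - kernel_covariance L x)
        \<le> (\<integral>\<^sup>+x. ennreal (2 * \<rho>) * h x + ?e x * ?s x \<partial>\<mu>)"
      unfolding lp_norm_pow_def power_one_right
      using h by (intro nn_integral_mono_AE, eventually_elim) (use bounds(2) in metis)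
    also have "\<dots> = ennreal (2 * \<rho>) * H + (\<integral>\<^sup>+x. ?e x * ?s x \<partial>\<mu>)"
      by (simp add: nn_integral_add nn_integral_cmult int_h)
    also have "\<dots> \<le> ennreal (2 * \<rho>) * H + bridge_spread \<mu> L * ennreal_sqrt (ennreal (8 * \<rho>) * H)"
      using cross by (rule add_left_mono)
    finally show ?thesis
      using mean by simp
  qed
  then show "lp_norm_pow 2 \<mu> (\<lambda>x. kernel_mean K x - kernel_mean L x) \<le> ennreal (2 * \<rho>) * H"
    and "lp_norm_pow 1 \<mu> (\<lambda>x. kernel_covariance K x - kernel_covariance L x)
      \<le> ennreal (2 * \<rho>) * H + bridge_spread \<mu> L * ennreal_sqrt (ennreal (8 * \<rho>) * H)"
    by blast+
qed

theorem corollary4p2: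
  fixes U V :: "real^'d \<Rightarrow> real"
    and \<alpha> :: "real^'d" and \<beta> \<tau> :: "real^'d^'d"
    and a_u b_u \<delta>_u a_v b_v \<delta>_v \<rho>_v :: real
    and \<mu> \<eta> :: "(real^'d) measure"
    and K_W L :: "real^'d \<Rightarrow> (real^'d) measure"
    and K :: "nat \<Rightarrow> real^'d \<Rightarrow> (real^'d) measure"
    and P B :: "((real^'d) \<times> (real^'d)) measure"
  assumes "positive_definite \<tau>" and "invertible \<beta>"
    and K_W: "K_W = potential_transition (gaussian_potential \<alpha> \<beta> \<tau>)"
    and mu: "\<mu> = gibbs_measure U" "prob_space \<mu>"
    and eta: "\<eta> = gibbs_measure V" "prob_space \<eta>"
    and "0 < a_u" "0 \<le> b_u" "0 \<le> \<delta>_u" and U: "curvature_bound U a_u b_u \<delta>_u"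
    and "0 < a_v" "0 \<le> b_v" "0 \<le> \<delta>_v" and V: "curvature_bound V a_v b_v \<delta>_v"
    and P: "P = kernel_product \<mu> K_W"
    and finite_entropy: "\<exists>Q\<in>couplings \<mu> \<eta>. relative_entropy Q P < \<top>"
    and B: "schroedinger_bridge P \<mu> \<eta> B"
    and L: "markov_transition L" "B = kernel_product \<mu> L"
    and K: "sinkhorn_transitions \<mu> \<eta> K_W K"
    and rho: "bridge_constant \<eta> L K \<rho>_v"
  shows "\<forall>n\<ge>1.
    lp_norm_pow 2 \<mu> (\<lambda>x. kernel_mean (K (2 * n)) x - kernel_mean L x)
      \<le> ennreal (2 * \<rho>_v) * relative_entropy B (sinkhorn_bridge \<mu> \<eta> K (2 * n)) \<and>
    lp_norm_pow 1 \<mu> (\<lambda>x. kernel_covariance (K (2 * n)) x - kernel_covariance L x)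
      \<le> ennreal (4 * \<rho>_v) * relative_entropy B (sinkhorn_bridge \<mu> \<eta> K (2 * n))
        + bridge_spread \<mu> L
          * ennreal_sqrt (ennreal (8 * \<rho>_v) * relative_entropy B (sinkhorn_bridge \<mu> \<eta> K (2 * n)))"
proof (intro allI impI)
  fix n :: nat
  assume "1 \<le> n"
  let ?K = "K (2 * n)" and ?H = "relative_entropy B (sinkhorn_bridge \<mu> \<eta> K (2 * n))"
  obtain m where m: "n = m + 1"
    using \<open>1 \<le> n\<close> by (metis add.commute le_Suc_ex)
  have markov_K: "markov_transition ?K"
    using K unfolding m sinkhorn_transitions_def cond_second_given_first_def by blast
  have sets_mu: "sets \<mu> = sets borel"
    by (simp add: mu gibbs_measure_def)
  have "0 < \<rho>_v" "quadratic_transport \<rho>_v (L x)" "quadratic_transport \<rho>_v (?K x)" for x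
    using rho \<open>1 \<le> n\<close> unfolding bridge_constant_def by blast+
  note bounds = kernel_product_moment_bounds[OF mu(2) sets_mu markov_K L(1) this]
  have H: "relative_entropy (kernel_product \<mu> L) (kernel_product \<mu> ?K) = ?H"
    by (simp add: L(2) sinkhorn_bridge_def)
  \<comment> \<open>The entropy term of the covariance bound comes out with the constant \<open>2 * \<rho>_v\<close>.\<close>
  have "ennreal (2 * \<rho>_v) * ?H \<le> ennreal (4 * \<rho>_v) * ?H"
    using \<open>0 < \<rho>_v\<close> by (intro mult_right_mono ennreal_leI) auto
  then show "lp_norm_pow 2 \<mu> (\<lambda>x. kernel_mean ?K x - kernel_mean L x) \<le> ennreal (2 * \<rho>_v) * ?H \<and>
    lp_norm_pow 1 \<mu> (\<lambda>x. kernel_covariance ?K x - kernel_covariance L x)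
      \<le> ennreal (4 * \<rho>_v) * ?H
        + bridge_spread \<mu> L * ennreal_sqrt (ennreal (8 * \<rho>_v) * ?H)"
    using bounds unfolding H by (meson add_right_mono order_trans)
qed

end
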